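(* Let $n\ge 1$, let $\mathcal F_i=\{F_{i1},\dots,F_{it_i}\}$, $i\in\{1,\dots,n\}$, be pairwise disjoint sets of cardinality $t_i$, with $t_i\ge 1$, and let $\mathbf F=(\mathcal F_1,\dots,\mathcal F_n)$. Define $m=\sum_{i=1}^n t_i$ and, for $k\in\{n,n+1,\dots,m\}$, let $C_k^{\mathbf F}$ be the family of all sets $\mathbf E=\{E_1,\dots,E_k\}$ such that each $E_u=F_{i(u)j(u)}$ for some $i(u)\in\{1,\dots,n\}$ and $j(u)\in\{1,\dots,t_{i(u)}\}$, $u\in\{1,\dots,k\}$, with $\{i(1),i(2),\dots,i(k)\}=\{1,\dots,n\}$ and $E_u\neq E_v$ for $u\neq v\in\{1,\dots,k\}$. Define $\mathfrak c(\mathbf F)=\sum_{k=n}^m|C_k^{\mathbf F}|$. Then $$\mathfrak c(\mathbf F)=\sum_{k=n}^m|C_k^{\mathbf F}|=\prod_{i=1}^n\left(2^{|\mathcal F_i|}-1\right).$$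
   Context: $C_k^{\mathbf F}$ is the family of $k$-element subsets of $\bigcup_{i=1}^n\mathcal F_i$ that contain at least one element of each $\mathcal F_i$. *)

theory Defs
  imports Main "HOL-Library.Disjoint_Sets"
begin

text \<open>
  The element \<open>F\<^sub>i\<^sub>j\<close> is written \<open>F i j\<close>, with \<open>i \<in> {1..n}\<close> and \<open>j \<in> {1..t i}\<close>; values of
  \<open>F\<close> and \<open>t\<close> outside these ranges are irrelevant. The functions \<open>i\<close> and \<open>j\<close> below are the index
  choices \<open>u \<mapsto> i(u)\<close> and \<open>u \<mapsto> j(u)\<close>; injectivity says \<open>E\<^sub>u \<noteq> E\<^sub>v\<close> for \<open>u \<noteq> v\<close>.
\<close>

definition choice_family :: "nat \<Rightarrow> (nat \<Rightarrow> nat) \<Rightarrow> (nat \<Rightarrow> nat \<Rightarrow> 'a) \<Rightarrow> nat \<Rightarrow> 'a set set" where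
  "choice_family n t F k =
     {(\<lambda>u. F (i u) (j u)) ` {1..k} | i j.
        (\<forall>u\<in>{1..k}. i u \<in> {1..n} \<and> j u \<in> {1..t (i u)}) \<and>
        i ` {1..k} = {1..n} \<and>
        inj_on (\<lambda>u. F (i u) (j u)) {1..k}}"

definition choice_count :: "nat \<Rightarrow> (nat \<Rightarrow> nat) \<Rightarrow> (nat \<Rightarrow> nat \<Rightarrow> 'a) \<Rightarrow> nat" where
  "choice_count n t F = (\<Sum>k = n..(\<Sum>i = 1..n. t i). card (choice_family n t F k))"

end

theory Submission
  imports Defs "HOL-Library.FuncSet"
begin

text \<open>
  For disjoint blocks, a subset of the union that meets every block is the same thing as an
  independent choice of a nonempty subset of each block, namely its traces on the blocks
  (\<open>card_hitting_sets\<close>). That accounts for the product of the numbers \<open>2 ^ card (\<F> i) - 1\<close>.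
  The sum counts the same sets, sorted by size. The indexed description of a choice, by functions
  \<open>i\<close> and \<open>j\<close> on \<open>{1..k}\<close>, only lists the elements of such a set of size \<open>k\<close> in some order
  (\<open>choice_family_eq_hitting_sets\<close>), and every size that occurs lies in the range of summation,
  since a set meeting \<open>n\<close> disjoint blocks has at least \<open>n\<close> elements
  (\<open>card_hitting_set_bounds\<close>).
\<close>

definition hitting_sets :: "'i set \<Rightarrow> ('i \<Rightarrow> 'a set) \<Rightarrow> 'a set set" where
  "hitting_sets I A = {E. E \<subseteq> (\<Union>i\<in>I. A i) \<and> (\<forall>i\<in>I. E \<inter> A i \<noteq> {})}"

lemma finite_hitting_sets:
  assumes "finite I" "\<And>i. i \<in> I \<Longrightarrow> finite (A i)"
  shows "finite (hitting_sets I A)"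
proof (rule finite_subset)
  show "hitting_sets I A \<subseteq> Pow (\<Union>i\<in>I. A i)"
    by (auto simp: hitting_sets_def)
  show "finite (Pow (\<Union>i\<in>I. A i))"
    using assms by simp
qed

lemma disjoint_family_on_index_unique:
  assumes "disjoint_family_on A I" "i \<in> I" "i' \<in> I" "x \<in> A i" "x \<in> A i'"
  shows "i = i'"
  using assms by (auto simp: disjoint_family_on_def)

text \<open>
  The tuple of traces \<open>E \<inter> A i\<close> determines \<open>E\<close>, because the blocks cover \<open>E\<close>. Disjointness makes
  every tuple of nonempty subsets occur: the trace of the union of the tuple on \<open>A i\<close> is its
  \<open>i\<close>-th entry.
\<close>

lemma bij_betw_traces_hitting_sets:
  assumes disj: "disjoint_family_on A I"
  shows "bij_betw (\<lambda>E. \<lambda>i\<in>I. E \<inter> A i) (hitting_sets I A) (\<Pi>\<^sub>E i\<in>I. Pow (A i) - {{}})"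
proof (rule bij_betw_byWitness[where f' = "\<lambda>B. \<Union>i\<in>I. B i"])
  show "\<forall>E\<in>hitting_sets I A. (\<Union>i\<in>I. (\<lambda>i\<in>I. E \<inter> A i) i) = E"
    by (auto simp: hitting_sets_def)
  show "\<forall>B\<in>\<Pi>\<^sub>E i\<in>I. Pow (A i) - {{}}. (\<lambda>i\<in>I. (\<Union>i\<in>I. B i) \<inter> A i) = B"
  proof
    fix B assume B: "B \<in> (\<Pi>\<^sub>E i\<in>I. Pow (A i) - {{}})"
    have sub: "B i \<subseteq> A i" if "i \<in> I" for i
      using PiE_mem[OF B that] by auto
    have "x \<in> B i" if "i \<in> I" "i' \<in> I" "x \<in> B i'" "x \<in> A i" for x i i'
      using disjoint_family_on_index_unique[OF disj that(1,2,4)] sub[OF that(2)] that(3) by auto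
    then have "(\<Union>i'\<in>I. B i') \<inter> A i = B i" if "i \<in> I" for i
      using sub[OF that] that by auto
    then show "(\<lambda>i\<in>I. (\<Union>i\<in>I. B i) \<inter> A i) = B"
      using B by (intro extensionalityI[of _ I]) (auto simp: PiE_def)
  qed
  show "(\<lambda>E. \<lambda>i\<in>I. E \<inter> A i) ` hitting_sets I A \<subseteq> (\<Pi>\<^sub>E i\<in>I. Pow (A i) - {{}})"
    by (auto simp: hitting_sets_def)
  show "(\<lambda>B. \<Union>i\<in>I. B i) ` (\<Pi>\<^sub>E i\<in>I. Pow (A i) - {{}}) \<subseteq> hitting_sets I A"
  proof clarify
    fix B assume B: "B \<in> (\<Pi>\<^sub>E i\<in>I. Pow (A i) - {{}})"
    have "B i \<subseteq> A i \<and> B i \<noteq> {}" if "i \<in> I" for i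
      using PiE_mem[OF B that] by auto
    then show "(\<Union>i\<in>I. B i) \<in> hitting_sets I A"
      unfolding hitting_sets_def by blast
  qed
qed

lemma card_hitting_sets:
  assumes "finite I" "\<And>i. i \<in> I \<Longrightarrow> finite (A i)" "disjoint_family_on A I"
  shows "card (hitting_sets I A) = (\<Prod>i\<in>I. 2 ^ card (A i) - 1)"
proof -
  have "card (hitting_sets I A) = card (\<Pi>\<^sub>E i\<in>I. Pow (A i) - {{}})"
    using bij_betw_traces_hitting_sets[OF assms(3)] by (rule bij_betw_same_card)
  also have "\<dots> = (\<Prod>i\<in>I. card (Pow (A i) - {{}}))"
    using assms(1) by (rule card_PiE)
  also have "\<dots> = (\<Prod>i\<in>I. 2 ^ card (A i) - 1)"
    using assms(2) by (intro prod.cong) (auto simp: card_Diff_singleton card_Pow)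
  finally show ?thesis .
qed

lemma card_hitting_set_bounds:
  assumes "finite I" "\<And>i. i \<in> I \<Longrightarrow> finite (A i)" "disjoint_family_on A I"
    and E: "E \<in> hitting_sets I A"
  shows "card I \<le> card E" and "card E \<le> (\<Sum>i\<in>I. card (A i))"
proof -
  have sub: "E \<subseteq> (\<Union>i\<in>I. A i)" and fin: "finite (\<Union>i\<in>I. A i)"
    using E assms(1,2) by (auto simp: hitting_sets_def)
  have "\<forall>i\<in>I. \<exists>x. x \<in> E \<inter> A i"
    using E by (auto simp: hitting_sets_def)
  then obtain f where f: "\<forall>i\<in>I. f i \<in> E \<inter> A i"
    by metis
  have "inj_on f I"
  proof (rule inj_onI)
    fix i i' assume "i \<in> I" "i' \<in> I" "f i = f i'"
    then show "i = i'"
      using f disjoint_family_on_index_unique[OF assms(3), of i i' "f i"] by auto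
  qed
  then show "card I \<le> card E"
    using f finite_subset[OF sub fin] by (intro card_inj_on_le) auto
  show "card E \<le> (\<Sum>i\<in>I. card (A i))"
    using card_mono[OF fin sub] card_UN_le[OF assms(1), of A] by linarith
qed

text \<open>
  Injectivity of the enumeration makes its index range the cardinality of the enumerated set.
  Conversely, any numbering of a hitting set yields index functions \<open>i\<close> and \<open>j\<close>; disjointness
  forces \<open>i(u)\<close> to be the block of the \<open>u\<close>-th element, so all blocks appear among its values.
\<close>

lemma choice_family_eq_hitting_sets:
  assumes A: "\<And>i. i \<in> {1..n} \<Longrightarrow> A i = F i ` {1..t i}"
    and disj: "disjoint_family_on A {1..n}"
  shows "choice_family n t F k = {E \<in> hitting_sets {1..n} A. card E = k}"
proof (intro set_eqI iffI)
  fix E assume "E \<in> choice_family n t F k"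
  then obtain i j where E: "E = (\<lambda>u. F (i u) (j u)) ` {1..k}"
    and ij: "\<And>u. u \<in> {1..k} \<Longrightarrow> i u \<in> {1..n} \<and> j u \<in> {1..t (i u)}"
    and surj: "i ` {1..k} = {1..n}"
    and inj: "inj_on (\<lambda>u. F (i u) (j u)) {1..k}"
    unfolding choice_family_def by blast
  have mem: "F (i u) (j u) \<in> A (i u)" if "u \<in> {1..k}" for u
    using ij[OF that] A by blast
  have "E \<inter> A l \<noteq> {}" if l: "l \<in> {1..n}" for l
  proof -
    obtain u where "u \<in> {1..k}" "l = i u"
      using l unfolding surj[symmetric] by blast
    then have "F (i u) (j u) \<in> E \<inter> A l"
      using mem E by simp
    then show ?thesis
      by blast
  qed
  moreover have "E \<subseteq> (\<Union>l\<in>{1..n}. A l)"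
    unfolding E using mem ij by blast
  moreover have "card E = k"
    using E card_image[OF inj] by simp
  ultimately show "E \<in> {E \<in> hitting_sets {1..n} A. card E = k}"
    by (simp add: hitting_sets_def)
next
  fix E assume "E \<in> {E \<in> hitting_sets {1..n} A. card E = k}"
  then have sub: "E \<subseteq> (\<Union>l\<in>{1..n}. A l)" and hit: "\<And>l. l \<in> {1..n} \<Longrightarrow> E \<inter> A l \<noteq> {}"
    and k: "card E = k"
    by (auto simp: hitting_sets_def)
  have "finite (\<Union>l\<in>{1..n}. A l)"
    using A by simp
  then have "finite E"
    using sub by (rule rev_finite_subset)
  then obtain e where e: "bij_betw e {1..k} E"
    using ex_bij_betw_nat_finite_1 k by blast
  have "\<forall>u\<in>{1..k}. \<exists>l j. l \<in> {1..n} \<and> j \<in> {1..t l} \<and> e u = F l j"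
  proof
    fix u assume "u \<in> {1..k}"
    then have "e u \<in> (\<Union>l\<in>{1..n}. A l)"
      using e sub bij_betwE by blast
    then show "\<exists>l j. l \<in> {1..n} \<and> j \<in> {1..t l} \<and> e u = F l j"
      using A by blast
  qed
  then obtain i j where ij: "\<And>u. u \<in> {1..k} \<Longrightarrow>
      i u \<in> {1..n} \<and> j u \<in> {1..t (i u)} \<and> e u = F (i u) (j u)"
    by metis
  have eq: "(\<lambda>u. F (i u) (j u)) ` {1..k} = E"
    using e ij by (auto simp: bij_betw_def)
  have "inj_on (\<lambda>u. F (i u) (j u)) {1..k} = inj_on e {1..k}"
    using ij by (intro inj_on_cong) simp
  then have inj: "inj_on (\<lambda>u. F (i u) (j u)) {1..k}"
    using e by (simp add: bij_betw_def)
  have "l \<in> i ` {1..k}" if l: "l \<in> {1..n}" for l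
  proof -
    obtain x where x: "x \<in> E" "x \<in> A l"
      using hit[OF l] by blast
    then obtain u where u: "u \<in> {1..k}" "x = F (i u) (j u)"
      unfolding eq[symmetric] by blast
    have "x \<in> A (i u)"
      using u ij[OF u(1)] A by blast
    then have "i u = l"
      using disjoint_family_on_index_unique[OF disj _ l _ x(2)] ij[OF u(1)] by blast
    then show ?thesis
      using u(1) by blast
  qed
  then have surj: "i ` {1..k} = {1..n}"
    using ij by blast
  show "E \<in> choice_family n t F k"
    unfolding choice_family_def mem_Collect_eq
    using eq ij inj surj by (intro exI[of _ i] exI[of _ j]) simp
qed

theorem lemma3:
  fixes n m :: nat
    and t :: "nat \<Rightarrow> nat"
    and F :: "nat \<Rightarrow> nat \<Rightarrow> 'a"
    and \<F> :: "nat \<Rightarrow> 'a set"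
  assumes "n \<ge> 1"
    and "\<And>i. i \<in> {1..n} \<Longrightarrow> t i \<ge> 1"
    and "\<And>i. i \<in> {1..n} \<Longrightarrow> \<F> i = F i ` {1..t i}"
    and "\<And>i. i \<in> {1..n} \<Longrightarrow> card (\<F> i) = t i"
    and "disjoint_family_on \<F> {1..n}"
    and "m = (\<Sum>i = 1..n. t i)"
  shows "choice_count n t F = (\<Sum>k = n..m. card (choice_family n t F k)) \<and>
         (\<Sum>k = n..m. card (choice_family n t F k)) = (\<Prod>i = 1..n. 2 ^ card (\<F> i) - 1)"
proof -
  let ?H = "hitting_sets {1..n} \<F>"
  have fin: "finite (\<F> i)" if "i \<in> {1..n}" for i
    using assms(3)[OF that] by simp
  have m: "m = (\<Sum>i = 1..n. card (\<F> i))"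
    using assms(4,6) by simp
  have size: "card E \<in> {n..m}" if "E \<in> ?H" for E
    using card_hitting_set_bounds[OF _ fin assms(5) that] m by simp
  have "(\<Sum>k = n..m. card (choice_family n t F k)) = (\<Sum>k = n..m. card {E \<in> ?H. card E = k})"
    using choice_family_eq_hitting_sets[OF assms(3,5)] by simp
  also have "\<dots> = card ?H"
  proof -
    have "finite ?H"
      using fin by (intro finite_hitting_sets) auto
    then have "(\<Sum>k = n..m. \<Sum>E\<in>{E \<in> ?H. card E = k}. 1) = (\<Sum>E\<in>?H. 1::nat)"
      using size by (intro sum.group) auto
    then show ?thesis
      by simp
  qed
  also have "\<dots> = (\<Prod>i = 1..n. 2 ^ card (\<F> i) - 1)"
    using fin assms(5) by (intro card_hitting_sets) auto
  finally show ?thesis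
    using assms(6) by (simp add: choice_count_def)
qed

end
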